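(* Let $\mathbf{X}\subset\mathbb{R}^d$ be a finite set, $k\ge1$ and $\Delta\ge 1$ integers, and let $C_{k+\Delta}$ be the set of the first $k+\Delta$ centers produced by the $k$-means++ seeding algorithm on $\mathbf{X}$. Then $$\mathbb{E}\big[\mathrm{cost}(\mathbf{X},C_{k+\Delta})\big]\le \min\Big\{\,2+\frac{1}{2e}+\Big(\ln\frac{2k}{\Delta}\Big)^+,\;\;1+\frac{k}{e(\Delta-1)}\Big\}\cdot 5\,\mathrm{OPT}_k(\mathbf{X}),$$ where $(a)^+=\max(a,0)$ and the second term in the minimum is interpreted as $+\infty$ when $\Delta=1$.
   Context: For a finite set $C\subset\mathbb{R}^d$ and a point $x$, $\mathrm{cost}(x,C)=\min_{c\in C}\|x-c\|^2$; for a finite set $\mathbf{Y}$, $\mathrm{cost}(\mathbf{Y},C)=\sum_{x\in\mathbf{Y}}\mathrm{cost}(x,C)$; $\mathrm{OPT}_i(\mathbf{Y})=\min_{C\subset\mathbb{R}^d,\,|C|=i}\mathrm{cost}(\mathbf{Y},C)$. The $k$-means++ seeding algorithm: choose $c_1$ uniformly at random from $\mathbf{X}$ and set $C_1=\{c_1\}$; for $t=1,2,\dots$, choose $x\in\mathbf{X}$ with probability $\mathrm{cost}(x,C_t)/\mathrm{cost}(\mathbf{X},C_t)$ and set $C_{t+1}=C_t\cup\{x\}$. Thus $C_t$ is the set of the first $t$ chosen centers. *)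

theory Defs
  imports "HOL-Analysis.Analysis" "HOL-Probability.Probability"
begin

definition pt_cost :: "real^'d \<Rightarrow> (real^'d) set \<Rightarrow> real" where
  "pt_cost x C = Min ((\<lambda>c. (norm (x - c))^2) ` C)"

definition set_cost :: "(real^'d) set \<Rightarrow> (real^'d) set \<Rightarrow> real" where
  "set_cost Y C = (\<Sum>x\<in>Y. pt_cost x C)"

definition OPT :: "nat \<Rightarrow> (real^'d) set \<Rightarrow> real" where
  "OPT i Y = (INF C \<in> {C. finite C \<and> card C = i}. set_cost Y C)"

definition d2_sample :: "(real^'d) set \<Rightarrow> (real^'d) set \<Rightarrow> (real^'d) pmf" where
  "d2_sample X C = embed_pmf (\<lambda>x. if x \<in> X then pt_cost x C / set_cost X C else 0)"

text \<open>One step of k-means++ seeding: the first center uniformly from X, later centers by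
  D^2 sampling.  If all points are already covered (cost 0) the sampling distribution is
  undefined; by convention the center set is then left unchanged (its cost stays 0).\<close>
definition kmpp_step :: "(real^'d) set \<Rightarrow> (real^'d) set \<Rightarrow> (real^'d) set pmf" where
  "kmpp_step X C =
     (if C = {} then map_pmf (\<lambda>c. {c}) (pmf_of_set X)
      else if set_cost X C = 0 then return_pmf C
      else map_pmf (\<lambda>x. insert x C) (d2_sample X C))"

fun kmpp :: "(real^'d) set \<Rightarrow> nat \<Rightarrow> (real^'d) set pmf" where
  "kmpp X 0 = return_pmf {}"
| "kmpp X (Suc t) = bind_pmf (kmpp X t) (kmpp_step X)"

end

theory Submission
  imports Defs
begin

text \<open>Compare the run with the clustering \<open>asg\<close> induced by an arbitrary set of \<open>k\<close> centers, and let
  \<open>H\<close>, \<open>U\<close> be the cost of the covered and of the \<open>u\<close> uncovered clusters. Counting an uncovered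
  cluster with five times its optimal cost turns \<open>H\<close> into a supermartingale \<open>h\<close>, and the average
  \<open>y = U/u\<close> is a supermartingale as well. A step hits an uncovered cluster with probability
  \<open>U/(H + U)\<close>. If \<open>h\<close> and \<open>y\<close> were constant and \<open>d\<close> is the number of remaining steps minus \<open>u\<close>,
  then \<open>u y (1 + y/h)^(-d)\<close> would be a martingale dominating the final uncovered cost; each of the
  tangents of this function at \<open>y = z h\<close> is a supermartingale even when \<open>h\<close> and \<open>y\<close> vary, and the
  tangent at the maximum \<open>z = 1/(d - 1)\<close> does not depend on \<open>y\<close>. This gives the bound
  \<open>1 + k/(e(\<Delta> - 1))\<close>. For the logarithmic bound the argument is used for \<open>s \<approx> \<Delta>/2\<close> clusters only;
  while more than \<open>s\<close> clusters are to be covered, every miss is charged \<open>h/u\<close>, which sums to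
  \<open>ln (k/s)\<close>.\<close>

section \<open>Cost of a single point\<close>

lemma pt_cost_nonneg: "finite C \<Longrightarrow> C \<noteq> {} \<Longrightarrow> 0 \<le> pt_cost x C"
  unfolding pt_cost_def by (subst Min_ge_iff) auto

lemma pt_cost_insert:
  "finite C \<Longrightarrow> C \<noteq> {} \<Longrightarrow> pt_cost x (insert y C) = min ((norm (x - y))\<^sup>2) (pt_cost x C)"
  unfolding pt_cost_def by simp

lemma pt_cost_singleton: "pt_cost x {y} = (norm (x - y))\<^sup>2"
  unfolding pt_cost_def by simp

lemma pt_cost_insert_le:
  "finite C \<Longrightarrow> C \<noteq> {} \<Longrightarrow> pt_cost x (insert y C) \<le> pt_cost x C"
  by (simp add: pt_cost_insert)

lemma exists_nearest_center:
  assumes "finite C" "C \<noteq> {}"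
  shows "\<exists>c\<in>C. pt_cost x C = (norm (x - c))\<^sup>2"
proof -
  have "pt_cost x C \<in> (\<lambda>c. (norm (x - c))\<^sup>2) ` C"
    unfolding pt_cost_def using assms by (intro Min_in) auto
  then show ?thesis by auto
qed

lemma pt_cost_triangle:
  assumes "finite C" "C \<noteq> {}"
  shows "sqrt (pt_cost x C) \<le> sqrt (pt_cost y C) + norm (x - y)"
proof -
  obtain c where c: "c \<in> C" "pt_cost y C = (norm (y - c))\<^sup>2"
    using exists_nearest_center[OF assms] by blast
  have "pt_cost x C \<le> (norm (x - c))\<^sup>2"
    unfolding pt_cost_def using assms c by (intro Min_le) auto
  then have "sqrt (pt_cost x C) \<le> norm (x - c)"
    by (simp add: real_le_lsqrt)
  also have "\<dots> \<le> norm (x - y) + norm (y - c)"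
    by (metis diff_add_cancel norm_triangle_ineq add_diff_eq)
  finally show ?thesis using c by simp
qed

section \<open>The factor 5: D^2 sampling inside one cluster\<close>

text \<open>Here \<open>f\<close> and \<open>g\<close> are the current costs of two points at
  distance \<open>d\<close>; each summand is the old cost of one point times the new cost of the
  other once the first is a center. If \<open>f\<close> is the smaller cost, then
  \<open>d\<^sup>2 \<le> f\<close> forces \<open>g \<le> 4 * f\<close>, and
  \<open>f < d\<^sup>2\<close> forces \<open>g \<le> 4 * d\<^sup>2\<close>; either way 1 + 4 =
  5.\<close>

lemma pair_cost_bound:
  fixes f g d :: real
  assumes "0 \<le> f" "0 \<le> g" "0 \<le> d" "sqrt f \<le> sqrt g + d" "sqrt g \<le> sqrt f + d"
  shows "f * min (d\<^sup>2) g + g * min (d\<^sup>2) f \<le> 5 * (min f g * d\<^sup>2)"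
proof -
  have *: "f * min (d\<^sup>2) g + g * min (d\<^sup>2) f \<le> 5 * (f * d\<^sup>2)"
    if "0 \<le> f" "f \<le> g" "sqrt g \<le> sqrt f + d" for f g :: real
  proof (cases "d\<^sup>2 \<le> f")
    case True
    then have "d \<le> sqrt f" using assms(3) by (simp add: real_le_rsqrt)
    then have "sqrt g \<le> 2 * sqrt f" using that by linarith
    then have "(sqrt g)\<^sup>2 \<le> (2 * sqrt f)\<^sup>2" using that by (intro power_mono) auto
    then have g: "g \<le> 4 * f" using that by (simp add: power_mult_distrib)
    have "f * min (d\<^sup>2) g + g * min (d\<^sup>2) f = (f + g) * d\<^sup>2"
      using True that by (simp add: min_def algebra_simps)
    also have "\<dots> \<le> (5 * f) * d\<^sup>2" using g by (intro mult_right_mono) auto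
    finally show ?thesis by simp
  next
    case False
    then have "sqrt f \<le> d" using assms(3) by (simp add: real_le_lsqrt)
    then have "sqrt g \<le> 2 * d" using that by linarith
    then have "(sqrt g)\<^sup>2 \<le> (2 * d)\<^sup>2" using that by (intro power_mono) auto
    then have "g \<le> 4 * d\<^sup>2" using that by (simp add: power_mult_distrib)
    then have "f * g \<le> f * (4 * d\<^sup>2)" using that by (intro mult_left_mono) auto
    moreover have "f * min (d\<^sup>2) g \<le> f * d\<^sup>2" using that by (intro mult_left_mono) auto
    ultimately show ?thesis using False by (simp add: min_def algebra_simps)
  qed
  show ?thesis
  proof (cases "f \<le> g")
    case True then show ?thesis using *[of f g] assms by (simp add: min_def)
  next
    case False then show ?thesis using *[of g f] assms by (simp add: min_def add.commute)
  qed
qed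

text \<open>Expanding around \<open>c\<close>, the double sum is the right side minus twice the
  squared norm of the sum of all \<open>x - c\<close>. Dropping that term admits every point
  \<open>c\<close>.\<close>

lemma sum_pairwise_dist_le:
  fixes c :: "'a :: real_inner"
  assumes "finite P"
  shows "(\<Sum>x\<in>P. \<Sum>y\<in>P. (norm (x - y))\<^sup>2) \<le> 2 * real (card P) * (\<Sum>x\<in>P. (norm (x - c))\<^sup>2)"
proof -
  have e: "(norm (x - y))\<^sup>2 = (norm (x - c))\<^sup>2 + (norm (y - c))\<^sup>2 - 2 * ((x - c) \<bullet> (y - c))" for x y
    unfolding power2_norm_eq_inner by (simp add: inner_diff inner_commute algebra_simps)
  let ?S = "\<Sum>x\<in>P. (norm (x - c))\<^sup>2" and ?v = "\<Sum>x\<in>P. x - c"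
  have "(\<Sum>x\<in>P. \<Sum>y\<in>P. 2 * ((x - c) \<bullet> (y - c))) = (\<Sum>x\<in>P. 2 * ((x - c) \<bullet> ?v))"
    by (simp only: inner_sum_right sum_distrib_left)
  also have "\<dots> = 2 * (?v \<bullet> ?v)"
    by (simp only: inner_sum_left sum_distrib_left)
  finally have "(\<Sum>x\<in>P. \<Sum>y\<in>P. 2 * ((x - c) \<bullet> (y - c))) \<ge> 0" by simp
  moreover have "(\<Sum>x\<in>P. \<Sum>y\<in>P. (norm (x - c))\<^sup>2) = real (card P) * ?S"
    by (simp add: sum_distrib_left)
  moreover have "(\<Sum>x\<in>P. \<Sum>y\<in>P. (norm (x - y))\<^sup>2) = (\<Sum>x\<in>P. \<Sum>y\<in>P.
      (norm (x - c))\<^sup>2 + (norm (y - c))\<^sup>2 - 2 * ((x - c) \<bullet> (y - c)))"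
    by (intro sum.cong refl e)
  ultimately show ?thesis
    by (simp add: sum.distrib sum_subtractf)
qed

text \<open>Peeling off the minimum of \<open>f\<close> replaces the layer-cake formula for \<open>min\<close>.\<close>
lemma sum_min_weighted_dist_le:
  fixes c :: "'a :: real_inner"
  assumes "finite P" "\<And>x. x \<in> P \<Longrightarrow> 0 \<le> f x"
  shows "(\<Sum>x\<in>P. \<Sum>y\<in>P. min (f x) (f y) * (norm (x - y))\<^sup>2)
    \<le> 2 * (\<Sum>x\<in>P. f x) * (\<Sum>x\<in>P. (norm (x - c))\<^sup>2)"
  using assms
proof (induction "card P" arbitrary: P f)
  case 0
  then show ?case by simp
next
  case (Suc n)
  have ne: "P \<noteq> {}" using Suc by auto
  define m where "m = Min (f ` P)"
  have "m \<in> f ` P" unfolding m_def using Suc ne by (intro Min_in) auto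
  then obtain a where a: "a \<in> P" "f a = m" by auto
  have m: "m \<le> f x" if "x \<in> P" for x unfolding m_def using Suc that by (intro Min_le) auto
  have m0: "0 \<le> m" using a Suc by auto
  define g where "g x = f x - m" for x
  \<comment> \<open>At the minimizer \<open>a\<close> the reduced weight \<open>g\<close> vanishes,
    so pairs containing \<open>a\<close> drop out and the induction hypothesis applies on
    \<open>Q\<close>. The constant part \<open>m\<close> is left to the unweighted pairwise
    sum.\<close>
  define Q where "Q = P - {a}"
  let ?S = "\<Sum>x\<in>P. (norm (x - c))\<^sup>2"
  have Q: "finite Q" "n = card Q" "Q \<subseteq> P" unfolding Q_def using Suc a by auto
  have IH: "(\<Sum>x\<in>Q. \<Sum>y\<in>Q. min (g x) (g y) * (norm (x - y))\<^sup>2)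
      \<le> 2 * (\<Sum>x\<in>Q. g x) * (\<Sum>x\<in>Q. (norm (x - c))\<^sup>2)"
    using Q m by (intro Suc(1)) (auto simp: g_def)
  have ga: "g a = 0" by (simp add: g_def a)
  have gn: "0 \<le> g x" if "x \<in> P" for x using m that by (simp add: g_def)
  have dropin: "(\<Sum>y\<in>P. min (g x) (g y) * (norm (x - y))\<^sup>2)
      = (\<Sum>y\<in>Q. min (g x) (g y) * (norm (x - y))\<^sup>2)" if "x \<in> P" for x
    unfolding Q_def using Suc(3) a gn[OF that] ga by (subst sum.remove[of _ a]) auto
  have a0: "(\<Sum>y\<in>Q. min (g a) (g y) * (norm (a - y))\<^sup>2) = 0"
    using gn Q ga by (intro sum.neutral) auto
  have "(\<Sum>x\<in>P. \<Sum>y\<in>P. min (g x) (g y) * (norm (x - y))\<^sup>2)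
      = (\<Sum>x\<in>P. \<Sum>y\<in>Q. min (g x) (g y) * (norm (x - y))\<^sup>2)"
    by (rule sum.cong[OF refl dropin])
  also have "\<dots> = (\<Sum>x\<in>Q. \<Sum>y\<in>Q. min (g x) (g y) * (norm (x - y))\<^sup>2)"
    unfolding Q_def[symmetric] using Suc(3) a a0 by (subst sum.remove[of _ a]) (auto simp: Q_def)
  also have "\<dots> \<le> 2 * (\<Sum>x\<in>Q. g x) * (\<Sum>x\<in>Q. (norm (x - c))\<^sup>2)" by (rule IH)
  also have "\<dots> \<le> 2 * (\<Sum>x\<in>P. g x) * ?S"
    using Q gn Suc(3) by (intro mult_mono mult_left_mono sum_mono2 mult_nonneg_nonneg sum_nonneg) auto
  finally have 1: "(\<Sum>x\<in>P. \<Sum>y\<in>P. min (g x) (g y) * (norm (x - y))\<^sup>2) \<le> 2 * (\<Sum>x\<in>P. g x) * ?S" .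
  have 2: "m * (\<Sum>x\<in>P. \<Sum>y\<in>P. (norm (x - y))\<^sup>2) \<le> m * (2 * real (card P) * ?S)"
    using sum_pairwise_dist_le[OF Suc(3)] m0 by (rule mult_left_mono)
  have "min (f x) (f y) = m + min (g x) (g y)" for x y by (simp add: g_def min_def)
  then have "(\<Sum>x\<in>P. \<Sum>y\<in>P. min (f x) (f y) * (norm (x - y))\<^sup>2)
     = m * (\<Sum>x\<in>P. \<Sum>y\<in>P. (norm (x - y))\<^sup>2) + (\<Sum>x\<in>P. \<Sum>y\<in>P. min (g x) (g y) * (norm (x - y))\<^sup>2)"
    by (simp add: distrib_right sum.distrib sum_distrib_left)
  also have "\<dots> \<le> m * (2 * real (card P) * ?S) + 2 * (\<Sum>x\<in>P. g x) * ?S" using 1 2 by linarith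
  also have "\<dots> = 2 * (\<Sum>x\<in>P. f x) * ?S"
    by (simp add: g_def sum_subtractf algebra_simps)
  finally show ?case .
qed

text \<open>After division by \<open>set_cost P C\<close> this bounds the expected new cost of a
  cluster, given that the sample lies in it. Adding the sum to its transpose makes
  \<open>pair_cost_bound\<close> applicable; this doubling cancels the factor 2 of
  \<open>sum_min_weighted_dist_le\<close>.\<close>

lemma D2_sampling_cluster_cost:
  fixes c :: "real^'d"
  assumes "finite P" "finite C" "C \<noteq> {}"
  shows "(\<Sum>y\<in>P. pt_cost y C * set_cost P (insert y C))
    \<le> 5 * set_cost P C * (\<Sum>x\<in>P. (norm (x - c))\<^sup>2)"
proof -
  let ?f = "\<lambda>x. pt_cost x C"
  let ?T = "\<Sum>y\<in>P. \<Sum>x\<in>P. ?f y * min ((norm (x - y))\<^sup>2) (?f x)"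
  have f0: "0 \<le> ?f x" for x using assms by (simp add: pt_cost_nonneg)
  have "?T + ?T = (\<Sum>y\<in>P. \<Sum>x\<in>P. ?f y * min ((norm (x - y))\<^sup>2) (?f x))
      + (\<Sum>y\<in>P. \<Sum>x\<in>P. ?f x * min ((norm (y - x))\<^sup>2) (?f y))"
    by (subst (2) sum.swap) simp
  also have "\<dots> = (\<Sum>y\<in>P. \<Sum>x\<in>P. ?f y * min ((norm (x - y))\<^sup>2) (?f x)
      + ?f x * min ((norm (x - y))\<^sup>2) (?f y))"
    by (simp add: sum.distrib norm_minus_commute)
  also have "\<dots> \<le> (\<Sum>y\<in>P. \<Sum>x\<in>P. 5 * (min (?f y) (?f x) * (norm (y - x))\<^sup>2))"
  proof (intro sum_mono)
    fix y x
    show "?f y * min ((norm (x - y))\<^sup>2) (?f x) + ?f x * min ((norm (x - y))\<^sup>2) (?f y)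
      \<le> 5 * (min (?f y) (?f x) * (norm (y - x))\<^sup>2)"
      using pair_cost_bound[of "?f y" "?f x" "norm (y - x)"] f0
        pt_cost_triangle[OF assms(2,3), of x y] pt_cost_triangle[OF assms(2,3), of y x]
      by (simp add: norm_minus_commute)
  qed
  also have "\<dots> = 5 * (\<Sum>y\<in>P. \<Sum>x\<in>P. min (?f y) (?f x) * (norm (y - x))\<^sup>2)"
    by (simp add: sum_distrib_left)
  also have "\<dots> \<le> 5 * (2 * (\<Sum>x\<in>P. ?f x) * (\<Sum>x\<in>P. (norm (x - c))\<^sup>2))"
    using sum_min_weighted_dist_le[OF assms(1), of ?f c] f0 by (intro mult_left_mono) auto
  finally have "?T \<le> 5 * (\<Sum>x\<in>P. ?f x) * (\<Sum>x\<in>P. (norm (x - c))\<^sup>2)" by simp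
  then show ?thesis
    using assms by (simp add: set_cost_def pt_cost_insert sum_distrib_left)
qed

section \<open>The expected cost as a recursion over the remaining samples\<close>

text \<open>The expected cost after \<open>n\<close> further samples. Division by \<open>0\<close> yields \<open>0\<close>, the value required when
  \<open>C\<close> already has cost \<open>0\<close>.\<close>
fun exp_cost :: "(real^'d) set \<Rightarrow> nat \<Rightarrow> (real^'d) set \<Rightarrow> real" where
  "exp_cost X 0 C = set_cost X C"
| "exp_cost X (Suc n) C = (\<Sum>x\<in>X. pt_cost x C * exp_cost X n (insert x C)) / set_cost X C"

lemma set_cost_nonneg: "finite C \<Longrightarrow> C \<noteq> {} \<Longrightarrow> 0 \<le> set_cost X C"
  unfolding set_cost_def by (intro sum_nonneg pt_cost_nonneg)

lemma set_cost_insert_le: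
  "finite C \<Longrightarrow> C \<noteq> {} \<Longrightarrow> set_cost X (insert y C) \<le> set_cost X C"
  unfolding set_cost_def by (intro sum_mono pt_cost_insert_le)

lemma exp_cost_le:
  "finite C \<Longrightarrow> C \<noteq> {} \<Longrightarrow> exp_cost X n C \<le> set_cost X C"
proof (induction n arbitrary: C)
  case (Suc n)
  have "(\<Sum>x\<in>X. pt_cost x C * exp_cost X n (insert x C)) \<le> (\<Sum>x\<in>X. pt_cost x C * set_cost X C)"
    using Suc(2,3) by (intro sum_mono mult_left_mono pt_cost_nonneg
      order_trans[OF Suc(1) set_cost_insert_le]) auto
  also have "\<dots> = set_cost X C * set_cost X C"
    by (simp add: set_cost_def sum_distrib_right)
  finally show ?case
    using set_cost_nonneg[OF Suc(2,3), of X]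
    by (cases "set_cost X C = 0") (auto simp: divide_simps)
qed simp

lemma pmf_d2_sample:
  assumes "finite X" "finite C" "C \<noteq> {}" "set_cost X C \<noteq> 0"
  shows "pmf (d2_sample X C) x = (if x \<in> X then pt_cost x C / set_cost X C else 0)"
proof -
  have f0: "0 \<le> pt_cost x C" for x using assms by (simp add: pt_cost_nonneg)
  have T: "0 < set_cost X C"
    using set_cost_nonneg[OF assms(2,3), of X] assms(4) by linarith
  define p where "p x = (if x \<in> X then pt_cost x C / set_cost X C else 0)" for x
  have p0: "0 \<le> p x" for x using f0 T by (simp add: p_def)
  have "(\<integral>\<^sup>+ x. ennreal (p x) \<partial>count_space UNIV) = (\<Sum>x\<in>X. ennreal (p x))"
    using assms by (intro nn_integral_count_space'[of X]) (auto simp: p_def)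
  also have "\<dots> = ennreal (\<Sum>x\<in>X. p x)" using p0 by (simp add: sum_ennreal)
  also have "(\<Sum>x\<in>X. p x) = 1"
    using T by (simp add: p_def set_cost_def flip: sum_divide_distrib)
  finally have p1: "(\<integral>\<^sup>+ x. ennreal (p x) \<partial>count_space UNIV) = 1" by simp
  show ?thesis
    unfolding d2_sample_def p_def[symmetric] using p0 p1 by (rule pmf_embed_pmf)
qed

lemma set_d2_sample:
  assumes "finite X" "finite C" "C \<noteq> {}" "set_cost X C \<noteq> 0"
  shows "set_pmf (d2_sample X C) \<subseteq> X"
  using pmf_d2_sample[OF assms] by (auto simp: set_pmf_iff split: if_splits)

lemma expectation_kmpp_step:
  assumes "finite X" "finite C" "C \<noteq> {}"
  shows "measure_pmf.expectation (kmpp_step X C) (exp_cost X n) = exp_cost X (Suc n) C"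
proof (cases "set_cost X C = 0")
  case True
  have "exp_cost X n C = 0" using True by (cases n) simp_all
  then show ?thesis using True assms by (simp add: kmpp_step_def)
next
  case False
  have "measure_pmf.expectation (d2_sample X C) (\<lambda>x. exp_cost X n (insert x C))
     = (\<Sum>x\<in>X. exp_cost X n (insert x C) * pmf (d2_sample X C) x)"
    using assms set_d2_sample[OF assms False] by (intro integral_measure_pmf_real) auto
  then show ?thesis
    using False assms by (simp add: kmpp_step_def pmf_d2_sample sum_divide_distrib algebra_simps)
qed

lemma set_kmpp_step:
  assumes "finite X" "X \<noteq> {}" "C \<subseteq> X"
  shows "set_pmf (kmpp_step X C) \<subseteq> Pow X - {{}}"
proof -
  have "finite C" using assms finite_subset by blast
  then show ?thesis
    using assms set_d2_sample[of X C] by (auto simp: kmpp_step_def split: if_splits)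
qed

lemma set_kmpp:
  assumes "finite X" "X \<noteq> {}"
  shows "set_pmf (kmpp X t) \<subseteq> Pow X"
proof (induction t)
  case (Suc t)
  show ?case
    unfolding kmpp.simps set_bind_pmf using Suc set_kmpp_step[OF assms] by blast
qed simp

lemma set_kmpp_Suc:
  assumes "finite X" "X \<noteq> {}"
  shows "set_pmf (kmpp X (Suc t)) \<subseteq> Pow X - {{}}"
  unfolding kmpp.simps set_bind_pmf using set_kmpp_step[OF assms] set_kmpp[OF assms, of t] by blast

text \<open>\<open>kmpp\<close> appends steps at the end, whereas \<open>exp_cost\<close> unfolds
  the next step, so the split point is moved back one step at a time. It stays at
  \<open>Suc t\<close> because the first center is drawn uniformly.\<close>

lemma expectation_kmpp_exp_cost:
  assumes "finite X" "X \<noteq> {}"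
  shows "measure_pmf.expectation (kmpp X (Suc t + n)) (set_cost X)
    = measure_pmf.expectation (kmpp X (Suc t)) (exp_cost X n)"
proof (induction n arbitrary: t)
  case 0
  show ?case by (simp add: exp_cost.simps(1)[abs_def] del: kmpp.simps)
next
  case (Suc n)
  let ?A = "Pow X - {{}}"
  have fA: "finite ?A" using assms by simp
  have fC: "finite C" if "C \<in> ?A" for C using assms that finite_subset by auto
  have fs: "finite (set_pmf (kmpp_step X C))" if "C \<in> ?A" for C
    using set_kmpp_step[OF assms, of C] that by (intro finite_subset[OF _ fA]) auto
  have "measure_pmf.expectation (kmpp X (Suc t + Suc n)) (set_cost X)
      = measure_pmf.expectation (kmpp X (Suc (Suc t))) (exp_cost X n)"
    using Suc[of "Suc t"] by (simp del: kmpp.simps)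
  also have "\<dots> = (\<Sum>C\<in>?A. pmf (kmpp X (Suc t)) C *\<^sub>R
      measure_pmf.expectation (kmpp_step X C) (exp_cost X n))"
    unfolding kmpp.simps(2)[of X "Suc t"]
    by (rule pmf_expectation_bind[OF fA fs set_kmpp_Suc[OF assms]])
  also have "\<dots> = (\<Sum>C\<in>?A. pmf (kmpp X (Suc t)) C *\<^sub>R exp_cost X (Suc n) C)"
    using fC assms by (intro sum.cong refl) (subst expectation_kmpp_step; auto)
  also have "\<dots> = measure_pmf.expectation (kmpp X (Suc t)) (exp_cost X (Suc n))"
    using set_kmpp_Suc[OF assms, of t] by (intro integral_measure_pmf[OF fA, symmetric]) blast
  finally show ?case .
qed

lemma expectation_kmpp_Suc:
  assumes "finite X" "X \<noteq> {}"
  shows "measure_pmf.expectation (kmpp X (Suc n)) (set_cost X)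
    = (\<Sum>c\<in>X. exp_cost X n {c}) / real (card X)"
  using expectation_kmpp_exp_cost[OF assms, of 0 n] assms
  by (simp add: bind_return_pmf kmpp_step_def integral_pmf_of_set)

section \<open>Covered and uncovered clusters, and the effect of one sample\<close>

locale clustering =
  fixes X :: "(real^'d) set" and asg :: "real^'d \<Rightarrow> real^'d"
  assumes fin: "finite X"
begin

definition clus :: "real^'d \<Rightarrow> (real^'d) set" where
  "clus i = {x \<in> X. asg x = i}"

text \<open>Measured from the assigned center \<open>i\<close>, which also names the cluster and may
  differ from its best center.\<close>

definition opt :: "real^'d \<Rightarrow> real" where
  "opt i = (\<Sum>x\<in>clus i. (norm (x - i))\<^sup>2)"

definition unc :: "(real^'d) set \<Rightarrow> (real^'d) set" where
  "unc C = asg ` X - asg ` C"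

definition unc_cost :: "(real^'d) set \<Rightarrow> real" where
  "unc_cost C = (\<Sum>i\<in>unc C. set_cost (clus i) C)"

definition cov_cost :: "(real^'d) set \<Rightarrow> real" where
  "cov_cost C = (\<Sum>i\<in>asg ` C. set_cost (clus i) C)"

text \<open>The quantity \<open>h\<close>; its 5 is that of \<open>D2_sampling_cluster_cost\<close>,
  so covering a cluster does not raise it on average.\<close>

definition pot :: "(real^'d) set \<Rightarrow> real" where
  "pot C = cov_cost C + 5 * (\<Sum>i\<in>unc C. opt i)"

definition avg_unc :: "(real^'d) set \<Rightarrow> real" where
  "avg_unc C = unc_cost C / real (card (unc C))"

lemma finite_clus: "finite (clus i)"
  using fin by (simp add: clus_def)

lemma finite_unc: "finite (unc C)"
  using fin by (simp add: unc_def)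

lemma opt_nonneg: "0 \<le> opt i"
  unfolding opt_def by (intro sum_nonneg) simp

lemma sum_clusters: "(\<Sum>x\<in>X. g x) = (\<Sum>i\<in>asg ` X. \<Sum>x\<in>clus i. g x)"
  unfolding clus_def by (rule sum.image_gen[OF fin])

lemma sum_clusters_split:
  assumes "C \<subseteq> X"
  shows "(\<Sum>x\<in>X. g x) = (\<Sum>i\<in>asg ` C. \<Sum>x\<in>clus i. g x) + (\<Sum>i\<in>unc C. \<Sum>x\<in>clus i. g x)"
  unfolding sum_clusters unc_def
  using sum.subset_diff[of "asg ` C" "asg ` X" "\<lambda>i. \<Sum>x\<in>clus i. g x"] assms fin
  by (simp add: image_mono add.commute)

context
  fixes C :: "(real^'d) set"
  assumes CX: "C \<subseteq> X" and Cne: "C \<noteq> {}"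
begin

lemma finC: "finite C"
  using CX fin finite_subset by blast

lemma set_cost_split: "set_cost X C = cov_cost C + unc_cost C"
  unfolding cov_cost_def unc_cost_def set_cost_def by (rule sum_clusters_split[OF CX])

lemma cov_cost_nonneg: "0 \<le> cov_cost C"
  unfolding cov_cost_def using finC Cne by (intro sum_nonneg set_cost_nonneg)

lemma unc_cost_nonneg: "0 \<le> unc_cost C"
  unfolding unc_cost_def using finC Cne by (intro sum_nonneg set_cost_nonneg)

lemma avg_unc_nonneg: "0 \<le> avg_unc C"
  unfolding avg_unc_def using unc_cost_nonneg by simp

lemma unc_cost_eq: "unc_cost C = real (card (unc C)) * avg_unc C"
  using finite_unc[of C] by (auto simp: avg_unc_def unc_cost_def)

lemma cov_cost_le_pot: "cov_cost C \<le> pot C"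
  unfolding pot_def using opt_nonneg by (simp add: sum_nonneg)

lemma pot_nonneg: "0 \<le> pot C"
  using cov_cost_le_pot cov_cost_nonneg by linarith

lemma unc_insert_miss:
  assumes "i \<in> asg ` C" "x \<in> clus i"
  shows "unc (insert x C) = unc C"
  using assms by (auto simp: unc_def clus_def)

lemma pot_insert_miss:
  assumes "i \<in> asg ` C" "x \<in> clus i"
  shows "pot (insert x C) \<le> pot C"
proof -
  have "asg ` insert x C = asg ` C" using assms by (auto simp: clus_def)
  then have "cov_cost (insert x C) \<le> cov_cost C"
    unfolding cov_cost_def using finC Cne by (auto intro!: sum_mono set_cost_insert_le)
  then show ?thesis unfolding pot_def using unc_insert_miss[OF assms] by simp
qed

lemma avg_unc_insert_miss:
  assumes "i \<in> asg ` C" "x \<in> clus i"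
  shows "avg_unc (insert x C) \<le> avg_unc C"
  unfolding avg_unc_def unc_cost_def unc_insert_miss[OF assms]
  using finC Cne by (intro divide_right_mono sum_mono set_cost_insert_le) auto

lemma unc_insert_hit:
  assumes "i \<in> unc C" "x \<in> clus i"
  shows "unc (insert x C) = unc C - {i}"
  using assms by (auto simp: unc_def clus_def)

lemma pot_insert_hit:
  assumes "i \<in> unc C" "x \<in> clus i"
  shows "pot (insert x C) \<le> pot C - 5 * opt i + set_cost (clus i) (insert x C)"
proof -
  have im: "asg ` insert x C = insert i (asg ` C)" "i \<notin> asg ` C"
    using assms by (auto simp: clus_def unc_def)
  have "cov_cost (insert x C)
      = set_cost (clus i) (insert x C) + (\<Sum>j\<in>asg ` C. set_cost (clus j) (insert x C))"
    unfolding cov_cost_def im(1) using im(2) finC by (subst sum.insert) auto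
  also have "(\<Sum>j\<in>asg ` C. set_cost (clus j) (insert x C)) \<le> cov_cost C"
    unfolding cov_cost_def using finC Cne by (auto intro!: sum_mono set_cost_insert_le)
  finally have "cov_cost (insert x C) \<le> set_cost (clus i) (insert x C) + cov_cost C" by simp
  moreover have "(\<Sum>j\<in>unc C. opt j) = opt i + (\<Sum>j\<in>unc C - {i}. opt j)"
    using assms finite_unc by (intro sum.remove) auto
  ultimately show ?thesis unfolding pot_def unc_insert_hit[OF assms] by simp
qed

text \<open>If the last uncovered cluster is hit, both sides are 0 through division by 0.\<close>

lemma avg_unc_insert_hit:
  assumes "i \<in> unc C" "x \<in> clus i"
  shows "avg_unc (insert x C) \<le> (unc_cost C - set_cost (clus i) C) / (real (card (unc C)) - 1)"
proof -
  have "unc_cost C = set_cost (clus i) C + (\<Sum>j\<in>unc C - {i}. set_cost (clus j) C)"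
    unfolding unc_cost_def using assms finite_unc by (intro sum.remove) auto
  moreover have "unc_cost (insert x C) \<le> (\<Sum>j\<in>unc C - {i}. set_cost (clus j) C)"
    unfolding unc_cost_def unc_insert_hit[OF assms]
    using finC Cne by (intro sum_mono set_cost_insert_le)
  ultimately have "unc_cost (insert x C) \<le> unc_cost C - set_cost (clus i) C" by simp
  moreover have "1 \<le> card (unc C)"
    using assms finite_unc[of C] by (auto simp: Suc_le_eq card_gt_0_iff)
  then have "real (card (unc (insert x C))) = real (card (unc C)) - 1"
    unfolding unc_insert_hit[OF assms] using assms finite_unc by (simp add: of_nat_diff)
  ultimately show ?thesis
    unfolding avg_unc_def using \<open>1 \<le> card (unc C)\<close> by (simp add: divide_right_mono)
qed

text \<open>By Cauchy--Schwarz the clusters are hit so that the average uncovered cost does not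
  increase in expectation.\<close>
lemma avg_unc_hit_bound:
  "(\<Sum>i\<in>unc C. set_cost (clus i) C *
      ((unc_cost C - set_cost (clus i) C) / (real (card (unc C)) - 1))) \<le> unc_cost C * avg_unc C"
proof (cases "card (unc C) \<le> 1")
  case True
  then consider "card (unc C) = 0" | "card (unc C) = 1" by linarith
  then show ?thesis
  proof cases
    case 1 then show ?thesis using finite_unc[of C] by (simp add: unc_cost_def)
  next
    case 2 then show ?thesis using unc_cost_nonneg avg_unc_nonneg by simp
  qed
next
  case False
  define u where "u = real (card (unc C))"
  define U where "U = unc_cost C"
  have u: "1 < u" using False by (simp add: u_def)
  have "U\<^sup>2 \<le> (\<Sum>i\<in>unc C. (set_cost (clus i) C)\<^sup>2) * u"
    unfolding U_def u_def unc_cost_def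
    using sum_squared_le_sum_of_squares[of "\<lambda>i. set_cost (clus i) C" "unc C"] finite_unc by simp
  then have cs: "U\<^sup>2 / u \<le> (\<Sum>i\<in>unc C. (set_cost (clus i) C)\<^sup>2)"
    using u by (simp add: divide_le_eq)
  have "(\<Sum>i\<in>unc C. set_cost (clus i) C) = U" by (simp add: U_def unc_cost_def)
  then have "(\<Sum>i\<in>unc C. set_cost (clus i) C * (U - set_cost (clus i) C))
      = U * U - (\<Sum>i\<in>unc C. (set_cost (clus i) C)\<^sup>2)"
    by (simp add: right_diff_distrib sum_subtractf power2_eq_square flip: sum_distrib_right)
  then have "(\<Sum>i\<in>unc C. set_cost (clus i) C * ((U - set_cost (clus i) C) / (u - 1)))
      = (U * U - (\<Sum>i\<in>unc C. (set_cost (clus i) C)\<^sup>2)) / (u - 1)"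
    by (simp flip: sum_divide_distrib)
  also have "\<dots> \<le> (U * U - U\<^sup>2 / u) / (u - 1)"
    using cs u by (intro divide_right_mono) auto
  also have "\<dots> = U * (U / u)"
    using u by (simp add: field_simps power2_eq_square)
  finally show ?thesis by (simp add: U_def u_def avg_unc_def)
qed

text \<open>Bounds that are linear in \<open>pot\<close> and \<open>avg_unc\<close> with nonnegative
  coefficients pass back through a sample: neither quantity grows on a miss, nor in expectation on a
  hit. The coefficients may differ between hit and miss, whose probabilities are proportional to
  \<open>unc_cost C\<close> and \<open>cov_cost C\<close>.\<close>

lemma exp_cost_step:
  assumes nn: "0 \<le> a1" "0 \<le> b1" "0 \<le> a2" "0 \<le> b2"
    and hit: "\<And>i x. i \<in> unc C \<Longrightarrow> x \<in> clus i \<Longrightarrow>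
      exp_cost X n (insert x C) \<le> a1 * pot (insert x C) + b1 * avg_unc (insert x C)"
    and miss: "\<And>i x. i \<in> asg ` C \<Longrightarrow> x \<in> clus i \<Longrightarrow>
      exp_cost X n (insert x C) \<le> a2 * pot (insert x C) + b2 * avg_unc (insert x C)"
  shows "set_cost X C * exp_cost X (Suc n) C
    \<le> unc_cost C * (a1 * pot C + b1 * avg_unc C) + cov_cost C * (a2 * pot C + b2 * avg_unc C)"
proof -
  let ?f = "\<lambda>x. pt_cost x C" and ?F = "\<lambda>i. set_cost (clus i) C"
  let ?W = "\<lambda>i. (unc_cost C - ?F i) / (real (card (unc C)) - 1)"
  have f0: "0 \<le> ?f x" for x using finC Cne by (simp add: pt_cost_nonneg)
  have "set_cost X C * exp_cost X (Suc n) C \<le> (\<Sum>x\<in>X. ?f x * exp_cost X n (insert x C))"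
  proof (cases "set_cost X C = 0")
    \<comment> \<open>With cost 0 all weights \<open>pt_cost x C\<close> vanish, so both sides are
      0.\<close>
    case True
    then have "\<forall>x\<in>X. ?f x = 0"
      unfolding set_cost_def using f0 fin by (subst (asm) sum_nonneg_eq_0_iff) auto
    then show ?thesis using True by simp
  qed simp
  also have "\<dots> = (\<Sum>i\<in>asg ` C. \<Sum>x\<in>clus i. ?f x * exp_cost X n (insert x C))
      + (\<Sum>i\<in>unc C. \<Sum>x\<in>clus i. ?f x * exp_cost X n (insert x C))"
    by (rule sum_clusters_split[OF CX])
  also have "(\<Sum>i\<in>asg ` C. \<Sum>x\<in>clus i. ?f x * exp_cost X n (insert x C))
      \<le> (\<Sum>i\<in>asg ` C. \<Sum>x\<in>clus i. ?f x * (a2 * pot C + b2 * avg_unc C))"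
    using nn f0 by (intro sum_mono mult_left_mono order_trans[OF miss] add_mono
        pot_insert_miss avg_unc_insert_miss) auto
  also have "\<dots> = cov_cost C * (a2 * pot C + b2 * avg_unc C)"
    by (simp only: cov_cost_def set_cost_def sum_distrib_right)
  also have "(\<Sum>i\<in>unc C. \<Sum>x\<in>clus i. ?f x * exp_cost X n (insert x C))
      \<le> (\<Sum>i\<in>unc C. ?F i * (a1 * pot C + b1 * ?W i))"
  proof (rule sum_mono)
    fix i assume i: "i \<in> unc C"
    have "(\<Sum>x\<in>clus i. ?f x * exp_cost X n (insert x C))
        \<le> (\<Sum>x\<in>clus i. ?f x * (a1 * (pot C - 5 * opt i + set_cost (clus i) (insert x C)) + b1 * ?W i))"
      using nn f0 i by (intro sum_mono mult_left_mono order_trans[OF hit[OF i]] add_mono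
          pot_insert_hit avg_unc_insert_hit) auto
    also have "\<dots> = ?F i * (a1 * (pot C - 5 * opt i) + b1 * ?W i)
        + a1 * (\<Sum>x\<in>clus i. ?f x * set_cost (clus i) (insert x C))"
    proof -
      have "(\<Sum>x\<in>P. f x * (a1 * (q + g x) + w)) = (\<Sum>x\<in>P. f x) * (a1 * q + w) + a1 * (\<Sum>x\<in>P. f x * g x)"
        for P :: "(real^'d) set" and f g q w
        unfolding sum_distrib_left sum_distrib_right sum.distrib[symmetric]
        by (intro sum.cong refl) (simp add: algebra_simps)
      then show ?thesis by (simp only: set_cost_def[of _ C])
    qed
    \<comment> \<open>The weighted new cost of the hit cluster is paid for by the term
      \<open>5 * opt i\<close> that leaves \<open>pot\<close>.\<close>
    also have "\<dots> \<le> ?F i * (a1 * (pot C - 5 * opt i) + b1 * ?W i) + a1 * (5 * ?F i * opt i)"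
      unfolding opt_def using nn finite_clus finC Cne
      by (intro add_left_mono mult_left_mono D2_sampling_cluster_cost) auto
    also have "\<dots> = ?F i * (a1 * pot C + b1 * ?W i)"
      by (simp add: algebra_simps)
    finally show "(\<Sum>x\<in>clus i. ?f x * exp_cost X n (insert x C)) \<le> ?F i * (a1 * pot C + b1 * ?W i)" .
  qed
  also have "\<dots> = unc_cost C * (a1 * pot C) + b1 * (\<Sum>i\<in>unc C. ?F i * ?W i)"
    by (simp only: distrib_left sum.distrib unc_cost_def sum_distrib_right sum_distrib_left mult.left_commute)
  also have "\<dots> \<le> unc_cost C * (a1 * pot C) + b1 * (unc_cost C * avg_unc C)"
    using nn by (intro add_left_mono mult_left_mono avg_unc_hit_bound) auto
  finally show ?thesis by (simp add: algebra_simps)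
qed

end

end

section \<open>Tangent bounds for the uncovered cost\<close>

text \<open>The tangent at \<open>y = z h\<close> of the function \<open>y (1 + y/h)^(-d)\<close>.\<close>
definition tangent_bound :: "nat \<Rightarrow> real \<Rightarrow> real \<Rightarrow> real \<Rightarrow> real" where
  "tangent_bound d z h y = (real d * z\<^sup>2 * h + (1 - (real d - 1) * z) * y) / (1 + z) ^ (d + 1)"

text \<open>Linearity in \<open>h\<close> and \<open>y\<close> gives the form that
  \<open>exp_cost_step\<close> accepts.\<close>

lemma tangent_bound_split: "tangent_bound d z h y = tangent_bound d z 1 0 * h + tangent_bound d z 0 1 * y"
  by (simp add: tangent_bound_def add_divide_distrib)

lemma tangent_bound_nonneg:
  "0 \<le> z \<Longrightarrow> (real d - 1) * z \<le> 1 \<Longrightarrow> 0 \<le> h \<Longrightarrow> 0 \<le> y \<Longrightarrow> 0 \<le> tangent_bound d z h y"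
  by (simp add: tangent_bound_def)

text \<open>After clearing denominators the difference is \<open>(1 - d z) (y - z h)\<^sup>2\<close>.\<close>
lemma tangent_bound_step:
  assumes "0 \<le> z" "real d * z \<le> 1"
  shows "h * tangent_bound d z h y \<le> (h + y) * tangent_bound (Suc d) z h y"
proof -
  have "0 \<le> (1 - real d * z) * (y - z * h)\<^sup>2" using assms by simp
  also have "\<dots> = (h + y) * (real (Suc d) * z\<^sup>2 * h + (1 - (real (Suc d) - 1) * z) * y)
      - (1 + z) * (h * (real d * z\<^sup>2 * h + (1 - (real d - 1) * z) * y))"
    by (simp add: power2_eq_square algebra_simps)
  finally have "(1 + z) * (h * (real d * z\<^sup>2 * h + (1 - (real d - 1) * z) * y)) / (1 + z) ^ (d + 2)
      \<le> (h + y) * (real (Suc d) * z\<^sup>2 * h + (1 - (real (Suc d) - 1) * z) * y) / (1 + z) ^ (d + 2)"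
    using assms by (intro divide_right_mono) auto
  then show ?thesis using assms by (simp add: tangent_bound_def)
qed

text \<open>For this slope parameter \<open>z\<close> the coefficient of \<open>y\<close> is 0 and
  \<open>z * h / (1 + z) ^ D\<close> remains. From
  \<open>1 / (1 + z) = 1 - 1 / D \<le> exp (- 1 / D)\<close> follows
  \<open>(1 + z) ^ D \<ge> exp 1\<close>.\<close>

lemma tangent_bound_max_le:
  assumes "2 \<le> D" "0 \<le> h"
  shows "tangent_bound D (1 / (real D - 1)) h y \<le> h / (exp 1 * (real D - 1))"
proof -
  define z where "z = 1 / (real D - 1)"
  have D: "real D \<ge> 2" and z: "0 < z" using assms by (auto simp: z_def)
  have z1: "1 + z = real D * z" and z2: "(real D - 1) * z = 1" and z3: "1 / (1 + z) = 1 - 1 / real D"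
    using D by (simp_all add: z_def field_simps)
  have "1 / (1 + z) \<le> exp (- (1 / real D))"
    unfolding z3 using exp_ge_add_one_self[of "- (1 / real D)"] by simp
  then have "exp (1 / real D) \<le> 1 + z"
    using z by (simp add: exp_minus field_simps)
  then have "exp (1 / real D) ^ D \<le> (1 + z) ^ D" by (intro power_mono) auto
  then have e: "exp 1 \<le> (1 + z) ^ D" using D by (simp flip: exp_of_nat_mult)
  have "tangent_bound D z h y = (real D * z) * (z * h) / ((1 + z) * (1 + z) ^ D)"
    using z2 by (simp add: tangent_bound_def power2_eq_square)
  also have "\<dots> = z * h / (1 + z) ^ D" unfolding z1[symmetric] using z by simp
  also have "\<dots> \<le> z * h / exp 1"
    using e z assms by (intro divide_left_mono) auto
  finally show ?thesis by (simp add: z_def field_simps)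
qed

section \<open>Induction over the samples\<close>

context clustering
begin

lemma exp_cost_le_pot_avg:
  assumes "C \<subseteq> X" "C \<noteq> {}"
  shows "exp_cost X n C \<le> pot C + real (card (unc C)) * avg_unc C"
  using exp_cost_le[OF finC[OF assms] assms(2), of X n] set_cost_split[OF assms]
    unc_cost_eq[OF assms] cov_cost_le_pot[OF assms] by linarith

lemma card_unc_insert_hit:
  assumes "i \<in> unc C" "x \<in> clus i"
  shows "card (unc (insert x C)) = card (unc C) - 1"
proof -
  have "unc (insert x C) = unc C - {i}" using assms by (auto simp: unc_def clus_def)
  then show ?thesis using assms finite_unc by simp
qed

lemma exp_cost_Suc_le:
  assumes "C \<subseteq> X" "C \<noteq> {}" "0 \<le> B"
    and "set_cost X C * exp_cost X (Suc n) C \<le> set_cost X C * B"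
  shows "exp_cost X (Suc n) C \<le> B"
proof (cases "set_cost X C = 0")
  case False
  then have "0 < set_cost X C"
    using set_cost_nonneg[OF finC[OF assms(1,2)] assms(2), of X] by linarith
  then show ?thesis using assms(4) by (simp only: mult_le_cancel_left_pos)
qed (use assms(3) in simp)

text \<open>Of the uncovered clusters, \<open>w\<close> get the tangent bound with surplus
  \<open>n - w\<close>, the others are charged the full average. A hit lowers \<open>w\<close> and
  keeps the surplus; a miss keeps \<open>w\<close> and lowers the surplus by 1. The number of fully
  charged clusters never changes.\<close>

lemma exp_cost_le_tangent_bound:
  assumes "0 \<le> z" "(real (n - w) - 1) * z \<le> 1" "w \<le> n" "w \<le> card (unc C)" "C \<subseteq> X" "C \<noteq> {}"
  shows "exp_cost X n C \<le> pot C + (real (card (unc C)) - real w) * avg_unc C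
    + real w * tangent_bound (n - w) z (pot C) (avg_unc C)"
  using assms(2-)
proof (induction n arbitrary: C w)
  case 0
  then show ?case using exp_cost_le_pot_avg[of C 0] by simp
next
  case (Suc m)
  note CX = Suc.prems(4,5)
  show ?case
  \<comment> \<open>At surplus 0 the tangent bound is just \<open>y\<close>, so both boundary cases
    say that the cost never increases.\<close>
  proof (cases "w = 0 \<or> w = Suc m")
    case True
    have "tangent_bound 0 z (pot C) (avg_unc C) = avg_unc C" using assms(1) by (simp add: tangent_bound_def)
    then show ?thesis using True exp_cost_le_pot_avg[OF CX, of "Suc m"]
      by (auto simp: algebra_simps)
  next
    case False
    then have w: "1 \<le> w" "w \<le> m" using Suc.prems by auto
    define e where "e = m - w"
    have e: "Suc m - w = Suc e" "m - (w - 1) = Suc e" using w by (auto simp: e_def)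
    have ez: "real e * z \<le> 1" using Suc.prems(1) e by simp
    then have ez': "(real e - 1) * z \<le> 1" using assms(1) by (simp add: algebra_simps)
    let ?u = "real (card (unc C))" and ?w = "real w"
    let ?h = "pot C" and ?y = "avg_unc C" and ?H = "cov_cost C" and ?U = "unc_cost C"
    let ?Ld = "tangent_bound (Suc e) z ?h ?y" and ?Le = "tangent_bound e z ?h ?y"
    have wu: "?w \<le> ?u" using Suc.prems by simp
    note nn = cov_cost_nonneg[OF CX] unc_cost_nonneg[OF CX] avg_unc_nonneg[OF CX] pot_nonneg[OF CX]
    have Ld0: "0 \<le> ?Ld" using assms(1) ez nn by (intro tangent_bound_nonneg) auto
    have tn: "0 \<le> tangent_bound (Suc e) z 1 0" "0 \<le> tangent_bound (Suc e) z 0 1" "0 \<le> tangent_bound e z 1 0" "0 \<le> tangent_bound e z 0 1"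
      using assms(1) ez ez' by (auto intro!: tangent_bound_nonneg)
    have step: "set_cost X C * exp_cost X (Suc m) C
      \<le> ?U * ((1 + (?w - 1) * tangent_bound (Suc e) z 1 0) * ?h + ((?u - ?w) + (?w - 1) * tangent_bound (Suc e) z 0 1) * ?y)
      + ?H * ((1 + ?w * tangent_bound e z 1 0) * ?h + ((?u - ?w) + ?w * tangent_bound e z 0 1) * ?y)"
    proof (rule exp_cost_step[OF CX])
      fix i x assume ix: "i \<in> unc C" "x \<in> clus i"
      have sub: "insert x C \<subseteq> X" using ix CX by (auto simp: clus_def)
      have c: "card (unc (insert x C)) = card (unc C) - 1" using card_unc_insert_hit[OF ix] .
      have wc: "real (card (unc C) - 1) = ?u - 1" "real (w - 1) = ?w - 1" using w wu by auto
      show "exp_cost X m (insert x C) \<le> (1 + (?w - 1) * tangent_bound (Suc e) z 1 0) * pot (insert x C)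
          + ((?u - ?w) + (?w - 1) * tangent_bound (Suc e) z 0 1) * avg_unc (insert x C)"
        using Suc.IH[of "w - 1" "insert x C"] sub w wu c wc e ez
        by (simp add: tangent_bound_split[of "Suc e" z "pot (insert x C)"] algebra_simps)
    next
      fix i x assume ix: "i \<in> asg ` C" "x \<in> clus i"
      have sub: "insert x C \<subseteq> X" using ix CX by (auto simp: clus_def)
      show "exp_cost X m (insert x C) \<le> (1 + ?w * tangent_bound e z 1 0) * pot (insert x C)
          + ((?u - ?w) + ?w * tangent_bound e z 0 1) * avg_unc (insert x C)"
        using Suc.IH[of w "insert x C"] sub w wu unc_insert_miss[OF CX ix] ez'
        by (simp add: tangent_bound_split[of "m - w" z "pot (insert x C)"] algebra_simps e_def)
    qed (use tn w wu in auto)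
    also have "\<dots> = ?U * (?h + (?u - ?w) * ?y + (?w - 1) * ?Ld) + ?H * (?h + (?u - ?w) * ?y + ?w * ?Le)"
      by (simp add: tangent_bound_split[of "Suc e" z ?h] tangent_bound_split[of e z ?h] algebra_simps)
    also have "\<dots> \<le> (?H + ?U) * (?h + (?u - ?w) * ?y + ?w * ?Ld)"
    proof -
      \<comment> \<open>The claim amounts to \<open>?w * ?H * (?Le - ?Ld) \<le> ?U * ?Ld\<close>. As
        \<open>?U = ?u * ?y\<close> and \<open>?w \<le> ?u\<close>, this inequality suffices; if
        \<open>?Le > ?Ld\<close>, replace \<open>?H\<close> by \<open>?h\<close> and use
        \<open>tangent_bound_step\<close>.\<close>
      have "?H * (?Le - ?Ld) \<le> ?y * ?Ld"
      proof (cases "?Le \<le> ?Ld")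
        case True
        then have "?H * (?Le - ?Ld) \<le> 0" using nn by (simp add: mult_nonneg_nonpos)
        also have "0 \<le> ?y * ?Ld" using nn Ld0 by simp
        finally show ?thesis .
      next
        case False
        then have "?H * (?Le - ?Ld) \<le> ?h * (?Le - ?Ld)"
          using cov_cost_le_pot[OF CX] by (intro mult_right_mono) auto
        also have "\<dots> \<le> ?y * ?Ld"
          using tangent_bound_step[OF assms(1) ez, of ?h ?y] by (simp add: algebra_simps)
        finally show ?thesis .
      qed
      then have "?w * (?H * (?Le - ?Ld)) \<le> ?w * (?y * ?Ld)" by (intro mult_left_mono) auto
      also have "\<dots> \<le> ?u * (?y * ?Ld)" using wu nn Ld0 by (intro mult_right_mono) auto
      also have "\<dots> = ?U * ?Ld" by (simp add: unc_cost_eq[OF CX])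
      finally show ?thesis by (simp add: algebra_simps)
    qed
    also have "\<dots> = set_cost X C * (?h + (?u - ?w) * ?y + ?w * ?Ld)"
      by (simp add: set_cost_split[OF CX])
    finally show ?thesis
      unfolding e using CX nn wu Ld0 by (intro exp_cost_Suc_le) auto
  qed
qed

text \<open>The surplus \<open>D\<close> stays fixed: hit and miss both lead from
  \<open>Suc j\<close> to \<open>j\<close>. A hit also lowers the number of uncovered clusters,
  whereas a miss leaves one more cluster to be charged its average cost.\<close>

lemma exp_cost_le_harmonic:
  assumes "0 \<le> a"
    and base: "\<And>C. C \<subseteq> X \<Longrightarrow> C \<noteq> {} \<Longrightarrow> s \<le> card (unc C) \<Longrightarrow>
      exp_cost X (s + D) C \<le> a * pot C + (real (card (unc C)) - real s) * avg_unc C"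
    and "s \<le> j" "j \<le> card (unc C)" "C \<subseteq> X" "C \<noteq> {}"
  shows "exp_cost X (j + D) C \<le> (a + (\<Sum>i\<in>{s<..j}. 1 / real i)) * pot C
    + (real (card (unc C)) - real j) * avg_unc C"
  using assms(3-)
proof (induction j arbitrary: C rule: dec_induct)
  case base
  then show ?case using assms(2) by simp
next
  case (step j)
  note CX = step.prems(2,3)
  let ?c = "a + (\<Sum>i\<in>{s<..j}. 1 / real i)"
  have c0: "0 \<le> ?c" using assms(1) by (auto intro!: add_nonneg_nonneg sum_nonneg)
  have "{s<..Suc j} = insert (Suc j) {s<..j}" using step.hyps by auto
  then have cS: "a + (\<Sum>i\<in>{s<..Suc j}. 1 / real i) = ?c + 1 / real (Suc j)" by simp
  let ?u = "real (card (unc C))"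
  let ?h = "pot C" and ?y = "avg_unc C" and ?H = "cov_cost C" and ?U = "unc_cost C"
  have ju: "real (Suc j) \<le> ?u" using step.prems(1) by simp
  note nn = cov_cost_nonneg[OF CX] unc_cost_nonneg[OF CX] avg_unc_nonneg[OF CX] pot_nonneg[OF CX]
  have "set_cost X C * exp_cost X (Suc (j + D)) C
    \<le> ?U * (?c * ?h + (?u - real (Suc j)) * ?y) + ?H * (?c * ?h + (?u - real j) * ?y)"
  proof (rule exp_cost_step[OF CX])
    fix i x assume ix: "i \<in> unc C" "x \<in> clus i"
    have sub: "insert x C \<subseteq> X" using ix CX by (auto simp: clus_def)
    have "j \<le> card (unc C) - 1" "real (card (unc C) - 1) = ?u - 1" using step.prems(1) by auto
    then show "exp_cost X (j + D) (insert x C)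
        \<le> ?c * pot (insert x C) + (?u - real (Suc j)) * avg_unc (insert x C)"
      using step.IH[of "insert x C"] sub card_unc_insert_hit[OF ix] by (simp add: algebra_simps)
  next
    fix i x assume ix: "i \<in> asg ` C" "x \<in> clus i"
    have sub: "insert x C \<subseteq> X" using ix CX by (auto simp: clus_def)
    then show "exp_cost X (j + D) (insert x C)
        \<le> ?c * pot (insert x C) + (?u - real j) * avg_unc (insert x C)"
      using step.IH[of "insert x C"] step.prems(1) unc_insert_miss[OF CX ix] by simp
  qed (use c0 ju in auto)
  also have "\<dots> = (?H + ?U) * (?c * ?h + (?u - real (Suc j)) * ?y) + ?H * ?y"
    by (simp add: algebra_simps)
  \<comment> \<open>The extra charge of a miss is at most \<open>?h / Suc j\<close> in expectation,
    because \<open>?U = ?u * ?y\<close> with \<open>Suc j \<le> ?u\<close>.\<close>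
  also have "?H * ?y \<le> (?H + ?U) * (1 / real (Suc j) * ?h)"
  proof -
    have "?H * ?y \<le> ?h * ?y" using nn cov_cost_le_pot[OF CX] by (intro mult_right_mono) auto
    also have "\<dots> = real (Suc j) * ?y * (1 / real (Suc j) * ?h)" by simp
    also have "\<dots> \<le> ?U * (1 / real (Suc j) * ?h)"
      unfolding unc_cost_eq[OF CX] using nn ju by (intro mult_right_mono) auto
    also have "\<dots> \<le> (?H + ?U) * (1 / real (Suc j) * ?h)"
      using nn by (intro mult_right_mono) auto
    finally show ?thesis .
  qed
  also have "(?H + ?U) * (?c * ?h + (?u - real (Suc j)) * ?y) + (?H + ?U) * (1 / real (Suc j) * ?h)
     = set_cost X C * ((?c + 1 / real (Suc j)) * ?h + (?u - real (Suc j)) * ?y)"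
    unfolding set_cost_split[OF CX] by (simp only: distrib_left distrib_right add.assoc add.left_commute add.commute)
  finally show ?case
    unfolding cS add_Suc using CX nn ju c0 by (intro exp_cost_Suc_le) (auto intro!: add_nonneg_nonneg mult_nonneg_nonneg)
qed

section \<open>The uniform first center and the bound for a fixed clustering\<close>

text \<open>A uniform center of cluster \<open>i\<close> costs at most \<open>2 * opt i\<close> on
  average; relaxing 2 to 5 makes the initial potential at most 5 times the total.\<close>

lemma sum_pot_singleton_le:
  "(\<Sum>c\<in>X. pot {c}) \<le> real (card X) * (5 * (\<Sum>i\<in>asg ` X. opt i))"
proof -
  let ?S = "\<Sum>i\<in>asg ` X. opt i"
  have p: "pot {c} = set_cost (clus i) {c} + 5 * (?S - opt i)" if "c \<in> clus i" for c i
  proof -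
    have "i \<in> asg ` X" "asg c = i" using that by (auto simp: clus_def)
    then show ?thesis
      using fin sum.remove[of "asg ` X" i opt] by (simp add: pot_def cov_cost_def unc_def)
  qed
  have "(\<Sum>c\<in>X. pot {c}) = (\<Sum>i\<in>asg ` X. \<Sum>c\<in>clus i. pot {c})" by (rule sum_clusters)
  also have "\<dots> \<le> (\<Sum>i\<in>asg ` X. \<Sum>c\<in>clus i. 5 * ?S)"
  proof (rule sum_mono)
    fix i
    have "(\<Sum>c\<in>clus i. pot {c}) = (\<Sum>c\<in>clus i. set_cost (clus i) {c} + 5 * (?S - opt i))"
      using p by (intro sum.cong refl) auto
    also have "\<dots> = (\<Sum>c\<in>clus i. set_cost (clus i) {c}) + real (card (clus i)) * (5 * (?S - opt i))"
      by (simp add: sum.distrib)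
    also have "(\<Sum>c\<in>clus i. set_cost (clus i) {c}) = (\<Sum>c\<in>clus i. \<Sum>x\<in>clus i. (norm (c - x))\<^sup>2)"
      by (simp add: set_cost_def pt_cost_singleton norm_minus_commute)
    also have "\<dots> \<le> 2 * real (card (clus i)) * opt i"
      unfolding opt_def by (rule sum_pairwise_dist_le[OF finite_clus])
    also have "\<dots> \<le> real (card (clus i)) * (5 * opt i)"
      using opt_nonneg[of i] by (simp add: mult_mono algebra_simps mult_left_mono)
    finally show "(\<Sum>c\<in>clus i. pot {c}) \<le> (\<Sum>c\<in>clus i. 5 * ?S)" by (simp add: algebra_simps)
  qed
  also have "\<dots> = (\<Sum>c\<in>X. 5 * ?S)" by (rule sum_clusters[symmetric])
  finally show ?thesis by simp
qed

lemma sum_opt: "(\<Sum>i\<in>asg ` X. opt i) = (\<Sum>x\<in>X. (norm (x - asg x))\<^sup>2)"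
  unfolding sum_clusters[of "\<lambda>x. (norm (x - asg x))\<^sup>2"] opt_def
  by (intro sum.cong refl) (auto simp: clus_def)

lemma expected_cost_bound:
  assumes "X \<noteq> {}" "s < card (asg ` X)" "2 \<le> D \<or> s = 0"
  shows "measure_pmf.expectation (kmpp X (card (asg ` X) + D)) (set_cost X)
    \<le> (1 + real s / (exp 1 * (real D - 1)) + (\<Sum>i\<in>{s<..card (asg ` X) - 1}. 1 / real i))
      * (5 * (\<Sum>x\<in>X. (norm (x - asg x))\<^sup>2))" (is "_ \<le> ?A * (5 * ?S)")
proof -
  let ?K = "card (asg ` X)" and ?a = "1 + real s / (exp 1 * (real D - 1))"
  have K: "?K + D = Suc (?K - 1 + D)" "s \<le> ?K - 1" using assms by auto
  have a0: "0 \<le> ?a" using assms(3) by (auto intro!: add_nonneg_nonneg)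
  have "0 \<le> (\<Sum>i\<in>{s<..?K - 1}. 1 / real i)" by (intro sum_nonneg) simp
  then have A0: "0 \<le> ?A" using a0 by linarith
  have base: "exp_cost X (s + D) C \<le> ?a * pot C + (real (card (unc C)) - real s) * avg_unc C"
    if C: "C \<subseteq> X" "C \<noteq> {}" "s \<le> card (unc C)" for C
  proof (cases "s = 0")
    case True
    then show ?thesis using exp_cost_le_pot_avg[OF C(1,2), of D] by simp
  next
    case False
    then have D: "2 \<le> D" using assms by simp
    let ?z = "1 / (real D - 1)"
    have "real s * tangent_bound D ?z (pot C) (avg_unc C) \<le> real s * (pot C / (exp 1 * (real D - 1)))"
      using tangent_bound_max_le[OF D pot_nonneg[OF C(1,2)]] by (intro mult_left_mono) auto
    moreover have "exp_cost X (s + D) C \<le> pot C + (real (card (unc C)) - real s) * avg_unc C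
      + real s * tangent_bound D ?z (pot C) (avg_unc C)"
      using exp_cost_le_tangent_bound[of ?z "s + D" s C] C D by simp
    ultimately show ?thesis by (simp add: algebra_simps)
  qed
  have 1: "exp_cost X (?K - 1 + D) {c} \<le> ?A * pot {c}" if "c \<in> X" for c
  proof -
    \<comment> \<open>Taking \<open>j\<close> equal to the number of uncovered clusters removes the
      \<open>avg_unc\<close> term.\<close>
    have "card (unc {c}) = ?K - 1" using that fin by (simp add: unc_def)
    then show ?thesis
      using exp_cost_le_harmonic[OF a0 base K(2), of "{c}"] that by simp
  qed
  have "measure_pmf.expectation (kmpp X (?K + D)) (set_cost X)
      = (\<Sum>c\<in>X. exp_cost X (?K - 1 + D) {c}) / real (card X)"
    unfolding K(1) by (rule expectation_kmpp_Suc[OF fin assms(1)])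
  also have "\<dots> \<le> (\<Sum>c\<in>X. ?A * pot {c}) / real (card X)"
    using 1 by (intro divide_right_mono sum_mono) auto
  also have "\<dots> = ?A * ((\<Sum>c\<in>X. pot {c}) / real (card X))"
    by (simp add: sum_distrib_left)
  also have "\<dots> \<le> ?A * (5 * ?S)"
    using A0 sum_pot_singleton_le assms(1) fin
    by (intro mult_left_mono) (auto simp: sum_opt divide_le_eq card_gt_0_iff mult.commute)
  finally show ?thesis .
qed

end

section \<open>Harmonic sums, the choice of \<open>s\<close>, and the infimum over center
  sets\<close>

lemma sum_inverse_le_ln:
  assumes "1 \<le> s" "s \<le> m"
  shows "(\<Sum>i\<in>{s<..m}. 1 / real i) \<le> ln (real m / real s)"
  using assms(2)
proof (induction m rule: dec_induct)
  case base
  then show ?case using assms by simp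
next
  case (step m)
  have m: "0 < real m" using step assms by simp
  have "{s<..Suc m} = insert (Suc m) {s<..m}" using step.hyps by auto
  then have "(\<Sum>i\<in>{s<..Suc m}. 1 / real i) = (\<Sum>i\<in>{s<..m}. 1 / real i) + 1 / real (Suc m)" by simp
  also have "\<dots> \<le> ln (real m / real s) + 1 / real (Suc m)" using step.IH by simp
  also have "1 / real (Suc m) \<le> - ln (real m / real (Suc m))"
    using ln_le_minus_one[of "real m / real (Suc m)"] m by (simp add: field_simps)
  also have "ln (real m / real s) + - ln (real m / real (Suc m)) = ln (real (Suc m) / real s)"
    using m assms by (simp add: ln_div)
  finally show ?case by simp
qed

lemma sum_inverse_le_one_plus_ln:
  assumes "1 \<le> m"
  shows "(\<Sum>i\<in>{0<..m}. 1 / real i) \<le> 1 + ln (real m)"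
proof -
  have "{0<..m} = insert 1 {1<..m}" using assms by auto
  then show ?thesis using sum_inverse_le_ln[of 1 m] assms by simp
qed

text \<open>If only \<open>K < k\<close> of the clusters are nonempty, then \<open>k + \<Delta>\<close> samples amount to the larger
  surplus \<open>\<Delta> + k - K\<close> for \<open>K\<close> clusters.\<close>
lemma expectation_kmpp_le:
  fixes X :: "(real^'d) set"
  assumes "finite X" "X \<noteq> {}" "finite C" "card C = k" "1 \<le> k" "1 \<le> \<Delta>"
  obtains K where "1 \<le> K" "K \<le> k"
    "\<And>s. s < K \<Longrightarrow> 2 \<le> \<Delta> \<or> s = 0 \<Longrightarrow>
      measure_pmf.expectation (kmpp X (k + \<Delta>)) (set_cost X)
      \<le> (1 + real s / (exp 1 * (real \<Delta> - 1)) + (\<Sum>i\<in>{s<..K - 1}. 1 / real i)) * (5 * set_cost X C)"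
proof -
  have Cne: "C \<noteq> {}" using assms by auto
  have "\<forall>x. \<exists>c. c \<in> C \<and> pt_cost x C = (norm (x - c))\<^sup>2"
    using exists_nearest_center[OF assms(3) Cne] by blast
  from choice[OF this] obtain asg
    where asg: "\<And>x. asg x \<in> C \<and> pt_cost x C = (norm (x - asg x))\<^sup>2" by blast
  interpret clustering X asg by standard (rule assms(1))
  let ?K = "card (asg ` X)"
  have "asg ` X \<subseteq> C" using asg by auto
  then have K: "1 \<le> ?K" "?K \<le> k"
    using assms(1-4) card_mono[of C "asg ` X"] by (simp_all add: Suc_le_eq card_gt_0_iff)
  have S: "(\<Sum>x\<in>X. (norm (x - asg x))\<^sup>2) = set_cost X C"
    using asg by (simp add: set_cost_def)
  have S0: "0 \<le> set_cost X C" using assms Cne by (simp add: set_cost_nonneg)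
  show ?thesis
  proof (rule that[OF K])
    fix s assume s: "s < ?K" "2 \<le> \<Delta> \<or> s = 0"
    define D where "D = k - ?K + \<Delta>"
    have D: "k + \<Delta> = ?K + D" "\<Delta> \<le> D" using K by (auto simp: D_def)
    have "real s / (exp 1 * (real D - 1)) \<le> real s / (exp 1 * (real \<Delta> - 1))"
    proof (cases "s = 0")
      case False
      then have "2 \<le> \<Delta>" using s by simp
      then show ?thesis using D by (intro divide_left_mono mult_left_mono mult_pos_pos) auto
    qed simp
    then have "(1 + real s / (exp 1 * (real D - 1)) + (\<Sum>i\<in>{s<..?K - 1}. 1 / real i)) * (5 * set_cost X C)
      \<le> (1 + real s / (exp 1 * (real \<Delta> - 1)) + (\<Sum>i\<in>{s<..?K - 1}. 1 / real i)) * (5 * set_cost X C)"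
      using S0 by (intro mult_right_mono) auto
    moreover have "2 \<le> D \<or> s = 0" using s(2) D(2) by auto
    ultimately show "measure_pmf.expectation (kmpp X (k + \<Delta>)) (set_cost X)
      \<le> (1 + real s / (exp 1 * (real \<Delta> - 1)) + (\<Sum>i\<in>{s<..?K - 1}. 1 / real i)) * (5 * set_cost X C)"
      using expected_cost_bound[OF assms(2) s(1), of D] unfolding D(1) S by linarith
  qed
qed

text \<open>The choice is the smaller of \<open>K - 1\<close> and \<open>\<Delta> div 2\<close>. In
  the first case the harmonic sum is empty; in the second the fraction and the loss from rounding
  \<open>\<Delta> / 2\<close> down cost 1/2 each.\<close>

lemma exists_seeding_factor_le:
  fixes K k \<Delta> :: nat
  assumes "1 \<le> K" "K \<le> k" "2 \<le> \<Delta>"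
  obtains s where "s < K" "1 + real s / (exp 1 * (real \<Delta> - 1)) + (\<Sum>i\<in>{s<..K - 1}. 1 / real i)
    \<le> 2 + max (ln (2 * real k / real \<Delta>)) 0"
proof (cases "K - 1 \<le> \<Delta> div 2")
  case True
  have "exp 1 \<ge> (2::real)" using exp_ge_add_one_self[of 1] by simp
  then have "2 * (real \<Delta> - 1) \<le> exp 1 * (real \<Delta> - 1)"
    using assms by (intro mult_right_mono) auto
  moreover have "real (K - 1) \<le> real \<Delta> - 1" using True assms by linarith
  ultimately have "real (K - 1) / (exp 1 * (real \<Delta> - 1)) \<le> 1"
    using assms by (simp add: divide_le_eq)
  then have "1 + real (K - 1) / (exp 1 * (real \<Delta> - 1)) + (\<Sum>i\<in>{K - 1<..K - 1}. 1 / real i)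
      \<le> 2 + max (ln (2 * real k / real \<Delta>)) 0"
    by simp
  then show ?thesis using that[of "K - 1"] assms(1) by simp
next
  case False
  define s where "s = \<Delta> div 2"
  have s: "1 \<le> s" "s \<le> K - 1" "s < K" using False assms by (auto simp: s_def)
  \<comment> \<open>Rounding is worst at \<open>\<Delta> = 3\<close>, where \<open>s = 1\<close>;
    hence the factor 3/2 inside the logarithm below.\<close>
  have "\<Delta> \<le> 3 * s" "s + 1 \<le> \<Delta>" using assms unfolding s_def by presburger+
  then have s3: "real \<Delta> \<le> 3 * real s" "real s \<le> real \<Delta> - 1" by linarith+
  have e2: "exp 1 \<ge> (2::real)" using exp_ge_add_one_self[of 1] by simp
  then have "2 * (real \<Delta> - 1) \<le> exp 1 * (real \<Delta> - 1)"
    using assms by (intro mult_right_mono) auto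
  then have "real s / (exp 1 * (real \<Delta> - 1)) \<le> 1 / 2"
    using s3 assms by (simp add: divide_le_eq)
  moreover have "(\<Sum>i\<in>{s<..K - 1}. 1 / real i) \<le> ln (2 * real k / real \<Delta>) + 1 / 2"
  proof -
    have "(\<Sum>i\<in>{s<..K - 1}. 1 / real i) \<le> ln (real (K - 1) / real s)"
      by (rule sum_inverse_le_ln[OF s(1,2)])
    also have "\<dots> \<le> ln (2 * real k / real \<Delta> * (3 / 2))"
    proof (subst ln_le_cancel_iff)
      have "real (K - 1) * real \<Delta> \<le> real k * (3 * real s)"
        using s3 assms by (intro mult_mono) auto
      then show "real (K - 1) / real s \<le> 2 * real k / real \<Delta> * (3 / 2)"
        using s assms by (simp add: field_simps)
    qed (use s assms in auto)
    also have "\<dots> = ln (2 * real k / real \<Delta>) + ln (3 / 2)"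
      using assms by (intro ln_mult_pos) auto
    also have "ln (3 / 2 :: real) \<le> 1 / 2" using ln_le_minus_one[of "3 / 2 :: real"] by simp
    finally show ?thesis by simp
  qed
  ultimately show ?thesis by (intro that[OF s(3)]) linarith
qed

text \<open>\<open>OPT\<close> is an infimum, so a bound against every \<open>C\<close> suffices;
  the space is infinite, so sets of size \<open>k\<close> exist.\<close>

lemma le_mult_OPT:
  assumes "0 \<le> a" "1 \<le> k"
    and "\<And>C. finite C \<Longrightarrow> card C = k \<Longrightarrow> v \<le> a * set_cost X C"
  shows "v \<le> a * OPT k (X :: (real^'d) set)"
proof -
  have "infinite (UNIV :: (real^'d) set)" by (simp add: infinite_UNIV_char_0)
  then obtain C0 :: "(real^'d) set" where C0: "finite C0" "card C0 = k"
    using infinite_arbitrarily_large by blast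
  show ?thesis
  proof (cases "a = 0")
    case True
    then show ?thesis using assms(3)[OF C0] by simp
  next
    case False
    then have a: "0 < a" using assms by simp
    have "v / a \<le> OPT k X"
      unfolding OPT_def
    proof (rule cINF_greatest)
      fix C :: "(real^'d) set" assume "C \<in> {C. finite C \<and> card C = k}"
      then show "v / a \<le> set_cost X C" using assms(3)[of C] a by (simp add: divide_le_eq mult.commute)
    qed (use C0 in auto)
    then show ?thesis using a by (simp add: divide_le_eq mult.commute)
  qed
qed

theorem mainTheorem2:
  fixes X :: "(real^'d) set" and k \<Delta> :: nat
  assumes "finite X" and "X \<noteq> {}" and "k \<ge> 1" and "\<Delta> \<ge> 1"
  shows "measure_pmf.expectation (kmpp X (k + \<Delta>)) (\<lambda>C. set_cost X C)
     \<le> (let A = 2 + 1 / (2 * exp 1) + max (ln (2 * real k / real \<Delta>)) 0;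
            B = 1 + real k / (exp 1 * (real \<Delta> - 1))
        in (if \<Delta> = 1 then A else min A B)) * 5 * OPT k X"
proof -
  let ?E = "measure_pmf.expectation (kmpp X (k + \<Delta>)) (\<lambda>C. set_cost X C)"
  define A where "A = 2 + 1 / (2 * exp 1) + max (ln (2 * real k / real \<Delta>)) 0"
  define B where "B = 1 + real k / (exp 1 * (real \<Delta> - 1))"
  have A2: "2 + max (ln (2 * real k / real \<Delta>)) 0 \<le> A" by (simp add: A_def)
  have A0: "0 \<le> A" and B0: "0 \<le> B" using assms by (auto simp: A_def B_def)
  have AB: "?E \<le> A * (5 * set_cost X C) \<and> (\<Delta> \<noteq> 1 \<longrightarrow> ?E \<le> B * (5 * set_cost X C))"
    if C: "finite C" "card C = k" for C
  proof -
    have S0: "0 \<le> 5 * set_cost X C" using C assms by (auto intro!: set_cost_nonneg)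
    obtain K where K: "1 \<le> K" "K \<le> k" and
      E: "\<And>s. s < K \<Longrightarrow> 2 \<le> \<Delta> \<or> s = 0 \<Longrightarrow>
        ?E \<le> (1 + real s / (exp 1 * (real \<Delta> - 1)) + (\<Sum>i\<in>{s<..K - 1}. 1 / real i)) * (5 * set_cost X C)"
      using expectation_kmpp_le[OF assms(1,2) C assms(3,4)] by blast
    show ?thesis
    proof (cases "\<Delta> = 1")
      case True
      \<comment> \<open>Without spare surplus \<open>s = 0\<close> is used: the fraction is 0 and
        the whole harmonic sum is charged.\<close>
      have "(\<Sum>i\<in>{0<..K - 1}. 1 / real i) \<le> 1 + max (ln (2 * real k)) 0"
      proof (cases "K = 1")
        case False
        then have "(\<Sum>i\<in>{0<..K - 1}. 1 / real i) \<le> 1 + ln (real (K - 1))"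
          using K by (intro sum_inverse_le_one_plus_ln) auto
        also have "ln (real (K - 1)) \<le> ln (2 * real k)" using K False by simp
        finally show ?thesis by simp
      qed simp
      then have "1 + real 0 / (exp 1 * (real \<Delta> - 1)) + (\<Sum>i\<in>{0<..K - 1}. 1 / real i) \<le> A"
        using A2 True by simp
      then show ?thesis
        using order_trans[OF E[of 0] mult_right_mono[OF _ S0]] K True by simp
    next
      case False
      then have D: "2 \<le> \<Delta>" using assms by simp
      obtain s where s: "s < K" and "1 + real s / (exp 1 * (real \<Delta> - 1))
          + (\<Sum>i\<in>{s<..K - 1}. 1 / real i) \<le> 2 + max (ln (2 * real k / real \<Delta>)) 0"
        using exists_seeding_factor_le[OF K D] by blast
      then have "1 + real s / (exp 1 * (real \<Delta> - 1)) + (\<Sum>i\<in>{s<..K - 1}. 1 / real i) \<le> A"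
        using A2 by linarith
      then have "?E \<le> A * (5 * set_cost X C)"
        using order_trans[OF E[OF s] mult_right_mono[OF _ S0]] D by simp
      \<comment> \<open>For \<open>B\<close> all \<open>K - 1\<close> clusters get the tangent bound
        and the harmonic sum is empty.\<close>
      moreover have "1 + real (K - 1) / (exp 1 * (real \<Delta> - 1)) + (\<Sum>i\<in>{K - 1<..K - 1}. 1 / real i) \<le> B"
        using D K by (auto simp: B_def intro!: divide_right_mono)
      then have "?E \<le> B * (5 * set_cost X C)"
        using order_trans[OF E[of "K - 1"] mult_right_mono[OF _ S0]] D K by simp
      ultimately show ?thesis by simp
    qed
  qed
  have "?E \<le> (A * 5) * OPT k X"
    using A0 assms(3) AB by (intro le_mult_OPT) (auto simp: mult.assoc)
  moreover have "?E \<le> (B * 5) * OPT k X" if "\<Delta> \<noteq> 1"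
    using B0 assms(3) AB that by (intro le_mult_OPT) (auto simp: mult.assoc)
  ultimately show ?thesis
    unfolding Let_def A_def[symmetric] B_def[symmetric] min_def by presburger
qed

end
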